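(* Let $\bar t=\inf\{t>0\mid B'_t=M\}$, where $B'_t=\{q\in M\mid d'(q_0,q)\le t\}$ and $q_0=\pi(\mathrm{Id})$. Then $$\bar t\le t_*:=\frac12\sqrt{\frac12\left(1+\sqrt{1+1024\pi^2}\right)}\approx3.56 .$$
   Context: $G$ is the 3D Heisenberg group of real unipotent upper triangular matrices $\begin{pmatrix}1&a&c\\0&1&b\\0&0&1\end{pmatrix}$, with coordinates $(a,b,c)$ and product $(a,b,c)\cdot(\bar a,\bar b,\bar c)=(a+\bar a,\,b+\bar b,\,c+\bar c+a\bar b)$. $H\subset G$ is the discrete subgroup of elements with $a,b,c\in\mathbb Z$, $M=H\backslash G=\{Hg\mid g\in G\}$ is the compact Heisenberg nil-manifold, and $\pi:G\to M$, $g\mapsto Hg$. The left-invariant fields $X_1=\partial_a$, $X_2=\partial_b+a\,\partial_c$ on $G$ (equivalently $X_1=\partial_x-\frac y2\partial_z$, $X_2=\partial_y+\frac x2\partial_z$ in coordinates $x=a$, $y=b$, $z=c-\frac{ab}2$) project to fields $X_1',X_2'$ on $M$. $d'$ is the sub-Riemannian distance on $M$ with orthonormal frame $X_1',X_2'$: $d'(q_0,q_1)$ is the infimum of $\int_0^{t_1}(u_1^2+u_2^2)^{1/2}dt$ over Lipschitz curves with $\dot q=u_1X_1'(q)+u_2X_2'(q)$ a.e. joining $q_0$ to $q_1$. *)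

theory Defs
  imports "HOL-Analysis.Analysis" "HOL-Algebra.Coset"
begin

type_synonym heis = "real \<times> real \<times> real"

fun heis_mult :: "heis \<Rightarrow> heis \<Rightarrow> heis" where
  "heis_mult (a, b, c) (a', b', c') = (a + a', b + b', c + c' + a * b')"

definition Heis :: "heis monoid" where
  "Heis = \<lparr>carrier = UNIV, monoid.mult = heis_mult, one = (0, 0, 0)\<rparr>"

definition HeisZ :: "heis set" where
  "HeisZ = \<int> \<times> \<int> \<times> \<int>"

fun heis_matrix :: "heis \<Rightarrow> real ^ 3 ^ 3" where
  "heis_matrix (a, b, c) =
     vector [vector [1, a, c], vector [0, 1, b], vector [0, 0, 1]]"

lemma heis_matrix_mult: "heis_matrix (heis_mult g h) = heis_matrix g ** heis_matrix h"
  by (cases g; cases h)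
     (simp add: matrix_matrix_mult_def vec_eq_iff forall_3 sum_3 algebra_simps)

lemma group_Heis: "group Heis"
proof (rule groupI)
  fix x assume "x \<in> carrier Heis"
  obtain a b c where x: "x = (a, b, c)" by (cases x)
  show "\<exists>y\<in>carrier Heis. y \<otimes>\<^bsub>Heis\<^esub> x = \<one>\<^bsub>Heis\<^esub>"
    by (rule bexI[of _ "(-a, -b, a * b - c)"]) (auto simp: Heis_def x)
qed (auto simp: Heis_def algebra_simps)

lemma subgroup_HeisZ: "subgroup HeisZ Heis"
proof -
  interpret group Heis by (rule group_Heis)
  have inv: "inv\<^bsub>Heis\<^esub> (a, b, c) = (-a, -b, a * b - c)" for a b c
    by (rule inv_equality) (auto simp: Heis_def)
  show ?thesis
  proof (rule subgroupI)
    show "inv\<^bsub>Heis\<^esub> x \<in> HeisZ" if "x \<in> HeisZ" for x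
      using that by (cases x) (auto simp: inv HeisZ_def)
  qed (auto simp: Heis_def HeisZ_def)
qed

definition nil_proj :: "heis \<Rightarrow> heis set" where
  "nil_proj g = HeisZ #>\<^bsub>Heis\<^esub> g"

definition nilmanifold :: "heis set set" where
  "nilmanifold = rcosets\<^bsub>Heis\<^esub> HeisZ"

text \<open>
  The smooth structure of the nilmanifold is the one that makes \<open>nil_proj\<close> a local
  diffeomorphism: its charts are the inverses of \<open>nil_proj\<close> on the open sets \<open>U\<close> on
  which \<open>nil_proj\<close> is injective.
\<close>

definition nil_chart :: "heis set \<Rightarrow> bool" where
  "nil_chart U \<longleftrightarrow> open U \<and> inj_on nil_proj U"

definition nil_coord :: "heis set \<Rightarrow> heis set \<Rightarrow> heis" where
  "nil_coord U = inv_into U nil_proj"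

fun X1 :: "heis \<Rightarrow> heis" where
  "X1 (a, b, c) = (1, 0, 0)"

fun X2 :: "heis \<Rightarrow> heis" where
  "X2 (a, b, c) = (0, 1, a)"

text \<open>
  In a chart, the differential of \<open>nil_proj\<close> maps \<open>X1\<close> and \<open>X2\<close> at any point of a coset
  to \<open>X1\<close> and \<open>X2\<close> at the coordinates of that coset.  So the projected fields are well
  defined, and in every chart they have the same expressions as \<open>X1\<close> and \<open>X2\<close>.
\<close>

lemma projected_fields:
  assumes U: "nil_chart U" and g: "nil_proj g \<in> nil_proj ` U"
  obtains D where "((nil_coord U \<circ> nil_proj) has_derivative D) (at g)"
    and "D (X1 g) = X1 (nil_coord U (nil_proj g))"
    and "D (X2 g) = X2 (nil_coord U (nil_proj g))"
proof -
  interpret group Heis by (rule group_Heis)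
  let ?p = "nil_coord U (nil_proj g)"
  have inj: "inj_on nil_proj U" and opU: "open U"
    using U by (auto simp: nil_chart_def)
  have pU: "?p \<in> U" and pp: "nil_proj ?p = nil_proj g"
    using g by (auto simp: nil_coord_def inv_into_into f_inv_into_f)
  have "?p \<in> nil_proj ?p"
    unfolding nil_proj_def by (rule rcos_self[OF _ subgroup_HeisZ]) (simp add: Heis_def)
  then have "?p \<in> HeisZ #>\<^bsub>Heis\<^esub> g"
    using pp by (simp add: nil_proj_def)
  then obtain h where h: "h \<in> HeisZ" "?p = heis_mult h g"
    by (auto simp: r_coset_def Heis_def)
  obtain k l m where hk: "h = (k, l, m)" by (cases h)
  define L where "L = heis_mult h"
  define D where "D = (\<lambda>(a, b, c). (a, b, c + k * b) :: heis)"
  have L_eq: "L = (\<lambda>x. (k + fst x, l + fst (snd x), m + snd (snd x) + k * fst (snd x)))"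
    by (rule ext) (auto simp: L_def hk)
  have D_eq: "D = (\<lambda>x. (fst x, fst (snd x), snd (snd x) + k * fst (snd x)))"
    by (rule ext) (auto simp: D_def)
  have L_D: "(L has_derivative D) (at g)"
    unfolding L_eq D_eq by (auto intro!: derivative_eq_intros)
  have "open (L -` U)"
    by (rule open_vimage[OF opU]) (auto simp: L_eq intro!: continuous_intros)
  moreover have "g \<in> L -` U"
    using pU h by (simp add: L_def)
  moreover have "L x = (nil_coord U \<circ> nil_proj) x" if "x \<in> L -` U" for x
  proof -
    have "nil_proj (L x) = nil_proj x"
    proof -
      have "HeisZ #>\<^bsub>Heis\<^esub> (h \<otimes>\<^bsub>Heis\<^esub> x) = (HeisZ #>\<^bsub>Heis\<^esub> h) #>\<^bsub>Heis\<^esub> x"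
        by (rule coset_mult_assoc[symmetric]) (auto simp: Heis_def)
      also have "HeisZ #>\<^bsub>Heis\<^esub> h = HeisZ"
        by (rule coset_join2[OF _ subgroup_HeisZ h(1)]) (simp add: Heis_def)
      finally show ?thesis
        by (simp add: nil_proj_def L_def Heis_def)
    qed
    then show ?thesis
      using that inj by (metis comp_apply inv_into_f_f nil_coord_def vimageE)
  qed
  ultimately have "((nil_coord U \<circ> nil_proj) has_derivative D) (at g)"
    using has_derivative_transform_within_open[OF L_D] by blast
  moreover have "D (X1 g) = X1 ?p" "D (X2 g) = X2 ?p"
    unfolding h(2) by (cases g; simp add: D_def hk)+
  ultimately show ?thesis by (rule that)
qed

text \<open>
  Lipschitz curves on the compact interval \<open>{0..T}\<close> are the curves that are locally
  Lipschitz in charts.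
\<close>

definition nil_lipschitz :: "real \<Rightarrow> (real \<Rightarrow> heis set) \<Rightarrow> bool" where
  "nil_lipschitz T q \<longleftrightarrow>
     (\<forall>t\<in>{0..T}. q t \<in> nilmanifold) \<and>
     (\<forall>t\<in>{0..T}. \<forall>U. nil_chart U \<and> q t \<in> nil_proj ` U \<longrightarrow>
        (\<exists>\<epsilon>>0. \<exists>C. (\<forall>s\<in>{0..T} \<inter> ball t \<epsilon>. q s \<in> nil_proj ` U) \<and>
           C-lipschitz_on ({0..T} \<inter> ball t \<epsilon>) (nil_coord U \<circ> q)))"

text \<open>
  The velocity of \<open>q\<close> at time \<open>t\<close> is the linear combination of the two projected fields
  with coefficients \<open>v1\<close>, \<open>v2\<close>, expressed in charts.
\<close>

definition nil_velocity :: "real \<Rightarrow> (real \<Rightarrow> heis set) \<Rightarrow> real \<Rightarrow> real \<Rightarrow> real \<Rightarrow> bool" where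
  "nil_velocity T q t v1 v2 \<longleftrightarrow>
     (\<forall>U. nil_chart U \<and> q t \<in> nil_proj ` U \<longrightarrow>
        ((nil_coord U \<circ> q) has_vector_derivative
          (v1 *\<^sub>R X1 (nil_coord U (q t)) + v2 *\<^sub>R X2 (nil_coord U (q t)))) (at t within {0..T}))"

text \<open>
  The set of lengths is never empty, since \<open>X1\<close>, \<open>X2\<close> and their bracket span every
  tangent space, so the real-valued infimum is the intended one.  Where a Lipschitz curve
  is horizontal, its velocity determines the controls, so they are measurable and bounded
  up to a null set, and the length is their Lebesgue integral.
\<close>

definition nil_dist :: "heis set \<Rightarrow> heis set \<Rightarrow> real" where
  "nil_dist q0 q1 = Inf {len. \<exists>T>0. \<exists>q u1 u2.
     nil_lipschitz T q \<and> q 0 = q0 \<and> q T = q1 \<and>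
     (AE t in lebesgue_on {0..T}. nil_velocity T q t (u1 t) (u2 t)) \<and>
     ((\<lambda>t. sqrt ((u1 t)\<^sup>2 + (u2 t)\<^sup>2)) has_integral len) {0..T}}"

definition nil_ball :: "heis set \<Rightarrow> real \<Rightarrow> heis set set" where
  "nil_ball q0 t = {q \<in> nilmanifold. nil_dist q0 q \<le> t}"

definition t_bar :: real where
  "t_bar = Inf {t. 0 < t \<and> nil_ball (nil_proj \<one>\<^bsub>Heis\<^esub>) t = nilmanifold}"

definition t_star :: real where
  "t_star = 1 / 2 * sqrt (1 / 2 * (1 + sqrt (1 + 1024 * pi\<^sup>2)))"

end

theory Submission
  imports Defs
begin

text \<open>
  In the coordinates \<open>x = a\<close>, \<open>y = b\<close>, \<open>z = c - a b / 2\<close> a horizontal curve from the identity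
  is a plane curve \<open>(x, y)\<close> from the origin; its length is that of the plane curve, and \<open>z\<close>
  is the signed area that the plane curve encloses with its chord.  So the distance from the
  identity to \<open>(x, y, z)\<close> is at most the length of any plane curve with chord \<open>(x, y)\<close> that
  encloses the area \<open>z\<close>.

  A good enough curve is the superposition of uniform motion along the chord, of length
  \<open>r = sqrt (x\<^sup>2 + y\<^sup>2)\<close>, with one turn around a circle of area \<open>\<bar>z\<bar>\<close>.  The speeds of the two
  motions are \<open>r\<close> and \<open>sqrt (4 * pi * \<bar>z\<bar>)\<close>, so by the triangle inequality the length is at
  most their sum (\<open>segment_plus_circle_bound\<close>, \<open>nil_dist_symmetric_coordinates_le\<close>).  Starting
  the circle at a point on the line of the chord makes the areas add up without a mixed term.  A
  superposition, unlike the circle followed by the segment, is a single smooth curve, and smooth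
  horizontal curves descend to admissible curves on the quotient
  (\<open>nil_dist_le_horizontal_curve\<close>).

  Left translation by the integer lattice moves any point to one with \<open>\<bar>x\<bar>, \<bar>y\<bar>, \<bar>z\<bar> \<le> 1/2\<close>
  (\<open>nilmanifold_reduced_representative\<close>).  Hence every point of the nilmanifold lies within
  \<open>sqrt (1/2) + sqrt (2 * pi)\<close>, about \<open>3.21\<close>, of the base point, and this is smaller than
  \<open>t_star\<close>.
\<close>

section \<open>Cosets of the integer lattice\<close>

lemma nil_proj_HeisZ_mult:
  assumes "h \<in> HeisZ"
  shows "nil_proj (heis_mult h g) = nil_proj g"
proof -
  interpret group Heis by (rule group_Heis)
  have "HeisZ #>\<^bsub>Heis\<^esub> (h \<otimes>\<^bsub>Heis\<^esub> g) = (HeisZ #>\<^bsub>Heis\<^esub> h) #>\<^bsub>Heis\<^esub> g"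
    by (rule coset_mult_assoc[symmetric]) (auto simp: Heis_def)
  also have "HeisZ #>\<^bsub>Heis\<^esub> h = HeisZ"
    by (rule coset_join2[OF _ subgroup_HeisZ assms]) (simp add: Heis_def)
  finally show ?thesis
    by (simp add: nil_proj_def Heis_def)
qed

lemma nil_proj_eqE:
  assumes "nil_proj p = nil_proj g"
  obtains h where "h \<in> HeisZ" "p = heis_mult h g"
proof -
  interpret group Heis by (rule group_Heis)
  have "p \<in> nil_proj p"
    unfolding nil_proj_def by (rule rcos_self[OF _ subgroup_HeisZ]) (simp add: Heis_def)
  then have "p \<in> HeisZ #>\<^bsub>Heis\<^esub> g"
    using assms by (simp add: nil_proj_def)
  then show ?thesis
    by (auto simp: r_coset_def Heis_def intro: that)
qed

lemma nil_proj_in_nilmanifold: "nil_proj g \<in> nilmanifold"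
  unfolding nil_proj_def nilmanifold_def RCOSETS_def by (auto simp: Heis_def simp del: split_paired_Ex)

lemma nilmanifoldE:
  assumes "q \<in> nilmanifold"
  obtains g where "q = nil_proj g"
  using assms by (auto simp: nil_proj_def nilmanifold_def RCOSETS_def)

lemma heis_mult_eq:
  "heis_mult h = (\<lambda>g. (fst h + fst g, fst (snd h) + fst (snd g),
     snd (snd h) + snd (snd g) + fst h * fst (snd g)))"
  by (cases h) auto

lemma continuous_on_heis_mult: "continuous_on S (heis_mult h)"
  unfolding heis_mult_eq by (intro continuous_intros)

text \<open>
  Left translation by \<open>h\<close> is an affine map, with translation vector \<open>h\<close> and linear part a shear.
\<close>

lemma lipschitz_heis_mult: "\<exists>C. C-lipschitz_on S (heis_mult h)"
proof -
  define L where "L g = (fst g, fst (snd g), snd (snd g) + fst h * fst (snd g))" for g :: heis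
  have "bounded_linear L"
    unfolding L_def by (intro bounded_linear_intros)
  then obtain C where C: "C-lipschitz_on S L"
    using bounded_linear.lipschitz_boundE by blast
  have "heis_mult h = (\<lambda>g. h + L g)"
    by (simp add: heis_mult_eq L_def plus_prod_def algebra_simps)
  then show ?thesis
    using lipschitz_on_add[OF lipschitz_on_constant[of S h] C] by auto
qed

text \<open>
  Two points of the same coset differ by a lattice element \<open>h\<close>, so near \<open>g\<close> the coordinate
  change of a chart is left translation by one fixed \<open>h\<close>: an affine, hence Lipschitz, map.
\<close>

lemma nil_coord_eq_translation:
  assumes U: "nil_chart U" and g: "nil_proj g \<in> nil_proj ` U"
  obtains h V where "h \<in> HeisZ" "open V" "g \<in> V"
    "\<And>x. x \<in> V \<Longrightarrow> nil_proj x \<in> nil_proj ` U"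
    "\<And>x. x \<in> V \<Longrightarrow> nil_coord U (nil_proj x) = heis_mult h x"
proof -
  have inj: "inj_on nil_proj U" and opU: "open U"
    using U by (auto simp: nil_chart_def)
  from g obtain p where p: "p \<in> U" "nil_proj p = nil_proj g" by auto
  from nil_proj_eqE[OF p(2)] obtain h where h: "h \<in> HeisZ" "p = heis_mult h g" by blast
  show ?thesis
  proof (rule that[OF h(1)])
    show "open (heis_mult h -` U)"
      by (rule open_vimage[OF opU continuous_on_heis_mult])
    show "g \<in> heis_mult h -` U"
      using p h by simp
    fix x assume x: "x \<in> heis_mult h -` U"
    then show "nil_proj x \<in> nil_proj ` U"
      by (metis h(1) image_eqI nil_proj_HeisZ_mult vimage_eq)
    show "nil_coord U (nil_proj x) = heis_mult h x"
      using inv_into_f_f[OF inj, of "heis_mult h x"] x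
      by (simp add: nil_coord_def nil_proj_HeisZ_mult[OF h(1)])
  qed
qed

section \<open>Projecting horizontal curves to the nilmanifold\<close>

lemma nil_lipschitz_nil_proj:
  assumes "C-lipschitz_on {0..T} \<gamma>"
  shows "nil_lipschitz T (nil_proj \<circ> \<gamma>)"
  unfolding nil_lipschitz_def
proof (intro conjI ballI allI impI)
  fix t assume "t \<in> {0..T}"
  show "(nil_proj \<circ> \<gamma>) t \<in> nilmanifold" by (simp add: nil_proj_in_nilmanifold)
next
  fix t U assume t: "t \<in> {0..T}" and "nil_chart U \<and> (nil_proj \<circ> \<gamma>) t \<in> nil_proj ` U"
  then obtain h V where V: "open V" "\<gamma> t \<in> V" "\<And>x. x \<in> V \<Longrightarrow> nil_proj x \<in> nil_proj ` U"
    "\<And>x. x \<in> V \<Longrightarrow> nil_coord U (nil_proj x) = heis_mult h x"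
    using nil_coord_eq_translation[of U "\<gamma> t"] by (metis comp_apply)
  have "continuous_on {0..T} \<gamma>"
    using assms lipschitz_on_continuous_on by blast
  then obtain \<epsilon> where \<epsilon>: "\<epsilon> > 0" "\<And>s. s \<in> {0..T} \<Longrightarrow> dist s t < \<epsilon> \<Longrightarrow> \<gamma> s \<in> V"
    using t V(1,2) by (metis continuous_on_iff open_dist)
  let ?S = "{0..T} \<inter> ball t \<epsilon>"
  have S: "\<gamma> s \<in> V" if "s \<in> ?S" for s
    using \<epsilon>(2)[of s] that by (auto simp: dist_commute)
  obtain D where D: "D-lipschitz_on (\<gamma> ` ?S) (heis_mult h)"
    using lipschitz_heis_mult by blast
  have "(D * C)-lipschitz_on ?S (heis_mult h \<circ> \<gamma>)"
    by (rule lipschitz_on_compose[OF lipschitz_on_subset[OF assms] D]) auto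
  then have "(D * C)-lipschitz_on ?S (nil_coord U \<circ> (nil_proj \<circ> \<gamma>))"
    by (rule lipschitz_on_transform) (simp add: S V(4))
  then show "\<exists>\<epsilon>>0. \<exists>C. (\<forall>s\<in>{0..T} \<inter> ball t \<epsilon>. (nil_proj \<circ> \<gamma>) s \<in> nil_proj ` U) \<and>
      C-lipschitz_on ({0..T} \<inter> ball t \<epsilon>) (nil_coord U \<circ> (nil_proj \<circ> \<gamma>))"
    using \<epsilon>(1) S V(3) by (metis comp_apply)
qed

lemma nil_velocity_nil_proj:
  assumes "(\<gamma> has_vector_derivative v1 *\<^sub>R X1 (\<gamma> t) + v2 *\<^sub>R X2 (\<gamma> t)) (at t within {0..T})"
  shows "nil_velocity T (nil_proj \<circ> \<gamma>) t v1 v2"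
  unfolding nil_velocity_def
proof (intro allI impI)
  fix U assume U: "nil_chart U \<and> (nil_proj \<circ> \<gamma>) t \<in> nil_proj ` U"
  then obtain D where D: "((nil_coord U \<circ> nil_proj) has_derivative D) (at (\<gamma> t))"
    "D (X1 (\<gamma> t)) = X1 (nil_coord U (nil_proj (\<gamma> t)))"
    "D (X2 (\<gamma> t)) = X2 (nil_coord U (nil_proj (\<gamma> t)))"
    using projected_fields[of U "\<gamma> t"] by (metis comp_apply)
  interpret linear D using D(1) by (rule has_derivative_linear)
  have D_v: "D (v1 *\<^sub>R X1 (\<gamma> t) + v2 *\<^sub>R X2 (\<gamma> t)) =
      v1 *\<^sub>R X1 (nil_coord U (nil_proj (\<gamma> t))) + v2 *\<^sub>R X2 (nil_coord U (nil_proj (\<gamma> t)))"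
    by (simp only: add scale D(2,3))
  show "((nil_coord U \<circ> (nil_proj \<circ> \<gamma>)) has_vector_derivative
      v1 *\<^sub>R X1 (nil_coord U ((nil_proj \<circ> \<gamma>) t)) + v2 *\<^sub>R X2 (nil_coord U ((nil_proj \<circ> \<gamma>) t)))
      (at t within {0..T})"
    using vector_derivative_diff_chain_within[OF assms has_derivative_at_withinI[OF D(1)]]
    unfolding D_v by (simp only: comp_assoc comp_apply[of nil_proj \<gamma>])
qed

lemma nil_dist_le_length:
  assumes "T > 0" "nil_lipschitz T q"
    and "AE t in lebesgue_on {0..T}. nil_velocity T q t (u1 t) (u2 t)"
    and "((\<lambda>t. sqrt ((u1 t)\<^sup>2 + (u2 t)\<^sup>2)) has_integral len) {0..T}"
  shows "nil_dist (q 0) (q T) \<le> len"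
  unfolding nil_dist_def
proof (rule cInf_lower, goal_cases)
  case 1
  show ?case using assms by blast
next
  case 2
  show ?case by (rule bdd_belowI[of _ 0]) (auto dest!: has_integral_nonneg)
qed

text \<open>
  The chain rule in charts shows that the projection of a \<open>C\<^sup>1\<close> horizontal curve is
  horizontal with the same controls.  Being \<open>C\<^sup>1\<close> on a compact interval also makes the
  curve Lipschitz, because its velocity \<open>(u1, u2, u2 * a)\<close> is bounded.  So every explicit
  horizontal curve in the Heisenberg group gives an upper bound for the distance on the quotient.
\<close>

lemma nil_dist_le_horizontal_curve:
  assumes T: "T > 0"
    and \<gamma>: "\<And>t. t \<in> {0..T} \<Longrightarrow>
      (\<gamma> has_vector_derivative u1 t *\<^sub>R X1 (\<gamma> t) + u2 t *\<^sub>R X2 (\<gamma> t)) (at t within {0..T})"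
    and u: "continuous_on {0..T} u1" "continuous_on {0..T} u2"
    and K: "\<And>t. t \<in> {0..T} \<Longrightarrow> sqrt ((u1 t)\<^sup>2 + (u2 t)\<^sup>2) \<le> K"
  shows "nil_dist (nil_proj (\<gamma> 0)) (nil_proj (\<gamma> T)) \<le> K * T"
proof -
  let ?v = "\<lambda>t. u1 t *\<^sub>R X1 (\<gamma> t) + u2 t *\<^sub>R X2 (\<gamma> t)"
  have v_eq: "?v = (\<lambda>t. (u1 t, u2 t, u2 t * fst (\<gamma> t)))"
  proof
    fix t show "?v t = (u1 t, u2 t, u2 t * fst (\<gamma> t))"
      by (cases "\<gamma> t") simp
  qed
  have "continuous_on {0..T} \<gamma>"
    using \<gamma> by (rule continuous_on_vector_derivative)
  then have "continuous_on {0..T} ?v"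
    unfolding v_eq using u by (intro continuous_intros)
  then have "bounded (?v ` {0..T})"
    by (intro compact_imp_bounded compact_continuous_image) auto
  then obtain C where C: "C > 0" "\<And>t. t \<in> {0..T} \<Longrightarrow> norm (?v t) \<le> C"
    unfolding bounded_pos by blast
  have lip: "C-lipschitz_on {0..T} \<gamma>"
  proof (rule lipschitz_onI)
    fix s t assume st: "s \<in> {0..T}" "t \<in> {0..T}"
    have "norm (\<gamma> s - \<gamma> t) \<le> C * norm (s - t)"
    proof (rule differentiable_bound[of "{0..T}" \<gamma> "\<lambda>t x. x *\<^sub>R ?v t"])
      show "(\<gamma> has_derivative (\<lambda>x. x *\<^sub>R ?v t)) (at t within {0..T})" if "t \<in> {0..T}" for t
        using \<gamma>[OF that] by (simp add: has_vector_derivative_def)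
      show "onorm (\<lambda>x. x *\<^sub>R ?v t) \<le> C" if "t \<in> {0..T}" for t
      proof (rule onorm_le)
        show "norm (x *\<^sub>R ?v t) \<le> C * norm x" for x
          using mult_left_mono[OF C(2)[OF that] abs_ge_zero[of x]]
          by (simp add: mult.commute del: scaleR_Pair)
      qed
    qed (use st in auto)
    then show "dist (\<gamma> s) (\<gamma> t) \<le> C * dist s t"
      by (simp add: dist_norm)
  qed (use C(1) in simp)
  let ?q = "nil_proj \<circ> \<gamma>" and ?l = "\<lambda>t. sqrt ((u1 t)\<^sup>2 + (u2 t)\<^sup>2)"
  have "?l integrable_on {0..T}"
    using u by (intro integrable_continuous_real continuous_intros)
  then have len: "(?l has_integral integral {0..T} ?l) {0..T}"
    by (rule integrable_integral)
  have vel: "AE t in lebesgue_on {0..T}. nil_velocity T ?q t (u1 t) (u2 t)"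
    by (rule AE_I2) (rule nil_velocity_nil_proj[OF \<gamma>], simp add: space_restrict_space)
  have "nil_dist (nil_proj (\<gamma> 0)) (nil_proj (\<gamma> T)) \<le> integral {0..T} ?l"
    using nil_dist_le_length[OF T nil_lipschitz_nil_proj[OF lip] vel len] by simp
  also have "\<dots> \<le> K * T"
    using has_integral_le[OF len has_integral_const_real[of K 0 T]] K T
    by (simp add: mult.commute)
  finally show ?thesis .
qed

section \<open>A segment superposed with a circle\<close>

text \<open>
  Here \<open>e = (e1, e2)\<close> is the direction of the chord, \<open>\<rho>\<close> the radius of the circle and \<open>s = \<plusminus>1\<close>
  its orientation.  The third coordinate \<open>r\<^sup>2 * e1 * e2 / 2 + s * pi * \<rho>\<^sup>2\<close> of the end point is
  \<open>x y / 2\<close> plus the signed area of the circle.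
\<close>

lemma segment_plus_circle_bound:
  fixes e1 e2 r \<rho> s :: real
  assumes e: "e1\<^sup>2 + e2\<^sup>2 = 1" and r: "r \<ge> 0" and \<rho>: "\<rho> \<ge> 0" and s: "s\<^sup>2 = 1"
  shows "nil_dist (nil_proj (0, 0, 0))
      (nil_proj (r * e1, r * e2, r\<^sup>2 * e1 * e2 / 2 + s * pi * \<rho>\<^sup>2)) \<le> r + 2 * pi * \<rho>"
proof -
  define \<theta> where "\<theta> t = 2 * pi * t" for t :: real
  \<comment> \<open>\<open>P\<close> and \<open>Q\<close> are the components of the plane curve along \<open>e\<close> and along its normal
    \<open>(- e2, e1)\<close>.  At time 0 the circle sits at \<open>\<rho> e\<close> relative to its centre; this phase
    makes the contributions of the segment to the enclosed area cancel over a full turn.\<close>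
  define P where "P t = r * t + \<rho> * (cos (\<theta> t) - 1)" for t
  define Q where "Q t = s * \<rho> * sin (\<theta> t)" for t
  define P' where "P' t = r - 2 * pi * \<rho> * sin (\<theta> t)" for t
  define Q' where "Q' t = 2 * pi * s * \<rho> * cos (\<theta> t)" for t
  \<comment> \<open>The area swept out up to time \<open>t\<close>: the antiderivative of \<open>(P Q' - Q P') / 2\<close> that
    vanishes at 0.\<close>
  define A where "A t = s * (pi * \<rho>\<^sup>2 * t - \<rho>\<^sup>2 * sin (\<theta> t) / 2
      + \<rho> * r * (t * sin (\<theta> t) + (cos (\<theta> t) - 1) / pi) / 2)" for t
  define a where "a t = e1 * P t - e2 * Q t" for t
  define b where "b t = e2 * P t + e1 * Q t" for t
  define \<gamma> where "\<gamma> t = (a t, b t, a t * b t / 2 + A t)" for t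
  define u1 where "u1 t = e1 * P' t - e2 * Q' t" for t
  define u2 where "u2 t = e2 * P' t + e1 * Q' t" for t
  have D\<theta>: "(\<theta> has_real_derivative 2 * pi) (at t within S)" for t S
    unfolding \<theta>_def by (auto intro!: derivative_eq_intros)
  note [derivative_intros] = DERIV_chain2[OF DERIV_cos D\<theta>]
  have DP: "(P has_real_derivative P' t) (at t within S)" for t S
    unfolding P_def P'_def by (auto intro!: derivative_eq_intros D\<theta>)
  have DQ: "(Q has_real_derivative Q' t) (at t within S)" for t S
    unfolding Q_def Q'_def by (auto intro!: derivative_eq_intros D\<theta>)
  have sc: "sin (\<theta> t) * sin (\<theta> t) = 1 - cos (\<theta> t) * cos (\<theta> t)" for t
    using sin_cos_squared_add[of "\<theta> t"] by (simp add: power2_eq_square algebra_simps)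
  have DA: "(A has_real_derivative (P t * Q' t - Q t * P' t) / 2) (at t within S)" for t S
  proof -
    have "(A has_real_derivative s * (pi * \<rho>\<^sup>2 - \<rho>\<^sup>2 * (cos (\<theta> t) * (2 * pi)) / 2
      + \<rho> * r * (sin (\<theta> t) + t * (cos (\<theta> t) * (2 * pi)) - sin (\<theta> t) * (2 * pi) / pi) / 2))
       (at t within S)"
      unfolding A_def by (auto intro!: derivative_eq_intros D\<theta>)
    also have "s * (pi * \<rho>\<^sup>2 - \<rho>\<^sup>2 * (cos (\<theta> t) * (2 * pi)) / 2
      + \<rho> * r * (sin (\<theta> t) + t * (cos (\<theta> t) * (2 * pi)) - sin (\<theta> t) * (2 * pi) / pi) / 2)
      = (P t * Q' t - Q t * P' t) / 2"
    proof -
      have "P t * Q' t - Q t * P' t = s * (2 * pi * \<rho>\<^sup>2 * (1 - cos (\<theta> t))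
          + \<rho> * r * (2 * pi * t * cos (\<theta> t) - sin (\<theta> t)))"
        unfolding P_def Q_def P'_def Q'_def using sc[of t] by algebra
      then show ?thesis by (simp add: field_simps)
    qed
    finally show ?thesis .
  qed
  have "nil_dist (nil_proj (\<gamma> 0)) (nil_proj (\<gamma> 1)) \<le> (r + 2 * pi * \<rho>) * 1"
  proof (rule nil_dist_le_horizontal_curve)
    fix t :: real assume "t \<in> {0..1}"
    have "(a has_real_derivative u1 t) (at t within {0..1})"
      unfolding a_def u1_def by (auto intro!: derivative_eq_intros DP DQ)
    moreover have "(b has_real_derivative u2 t) (at t within {0..1})"
      unfolding b_def u2_def by (auto intro!: derivative_eq_intros DP DQ)
    moreover have "((\<lambda>t. a t * b t / 2 + A t) has_real_derivative a t * u2 t) (at t within {0..1})"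
    proof -
      have "((\<lambda>t. a t * b t / 2 + A t) has_real_derivative
         (a t * u2 t + u1 t * b t) / 2 + (P t * Q' t - Q t * P' t) / 2) (at t within {0..1})"
        by (auto intro!: derivative_eq_intros calculation DA)
      \<comment> \<open>The rotation from \<open>(P, Q)\<close> to \<open>(a, b)\<close> preserves the area form, so the swept
        area supplies what the derivative of \<open>a b / 2\<close> lacks to \<open>a b'\<close>.\<close>
      also have "(a t * u2 t + u1 t * b t) / 2 + (P t * Q' t - Q t * P' t) / 2 = a t * u2 t"
      proof -
        have "P t * Q' t - Q t * P' t = a t * u2 t - u1 t * b t"
          unfolding a_def b_def u1_def u2_def using e by algebra
        then show ?thesis by (simp add: field_simps)
      qed
      finally show ?thesis .
    qed
    ultimately show "(\<gamma> has_vector_derivative u1 t *\<^sub>R X1 (\<gamma> t) + u2 t *\<^sub>R X2 (\<gamma> t)) (at t within {0..1})"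
      unfolding \<gamma>_def
      by (auto intro!: has_vector_derivative_Pair simp: has_real_derivative_iff_has_vector_derivative mult.commute)
    have "(u1 t)\<^sup>2 + (u2 t)\<^sup>2 = (P' t)\<^sup>2 + (Q' t)\<^sup>2"
      unfolding u1_def u2_def using e by algebra
    also have "\<dots> = r\<^sup>2 + (2 * pi * \<rho>)\<^sup>2 + 2 * r * (2 * pi * \<rho>) * (- sin (\<theta> t))"
      unfolding P'_def Q'_def using sc[of t] s by algebra
    also have "\<dots> \<le> r\<^sup>2 + (2 * pi * \<rho>)\<^sup>2 + 2 * r * (2 * pi * \<rho>) * 1"
      using r \<rho> sin_ge_minus_one[of "\<theta> t"] by (intro add_left_mono mult_left_mono) auto
    also have "\<dots> = (r + 2 * pi * \<rho>)\<^sup>2"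
      by (simp add: power2_eq_square algebra_simps)
    finally show "sqrt ((u1 t)\<^sup>2 + (u2 t)\<^sup>2) \<le> r + 2 * pi * \<rho>"
      using r \<rho> by (intro real_le_lsqrt) auto
  next
    show "continuous_on {0..1} u1" "continuous_on {0..1} u2"
      unfolding u1_def u2_def P'_def Q'_def \<theta>_def by (intro continuous_intros)+
  qed simp
  moreover have "\<gamma> 0 = (0, 0, 0)"
    by (simp add: \<gamma>_def a_def b_def A_def P_def Q_def \<theta>_def)
  moreover have "\<gamma> 1 = (r * e1, r * e2, r\<^sup>2 * e1 * e2 / 2 + s * pi * \<rho>\<^sup>2)"
    by (simp add: \<gamma>_def a_def b_def A_def P_def Q_def \<theta>_def power2_eq_square)
  ultimately show ?thesis by simp
qed

text \<open>
  A circle of area \<open>\<bar>z\<bar>\<close> has radius \<open>sqrt (\<bar>z\<bar> / pi)\<close> and circumference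
  \<open>sqrt (4 * pi * \<bar>z\<bar>)\<close>; the sign of \<open>z\<close> is the orientation.
\<close>

lemma nil_dist_symmetric_coordinates_le:
  "nil_dist (nil_proj (0, 0, 0)) (nil_proj (x, y, z + x * y / 2))
     \<le> sqrt (x\<^sup>2 + y\<^sup>2) + sqrt (4 * pi * \<bar>z\<bar>)"
proof -
  define r where "r = sqrt (x\<^sup>2 + y\<^sup>2)"
  obtain e1 e2 where e: "e1\<^sup>2 + e2\<^sup>2 = 1" "x = r * e1" "y = r * e2"
  proof (cases "r = 0")
    case True
    then show ?thesis using that[of 1 0] by (simp add: r_def sum_power2_eq_zero_iff)
  next
    case False
    have "(x / r)\<^sup>2 + (y / r)\<^sup>2 = (x\<^sup>2 + y\<^sup>2) / r\<^sup>2"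
      by (simp add: power_divide add_divide_distrib)
    also have "\<dots> = 1" using False by (simp add: r_def)
    finally show ?thesis using False by (intro that[of "x / r" "y / r"]) auto
  qed
  define s :: real where "s = (if z \<ge> 0 then 1 else -1)"
  define \<rho> where "\<rho> = sqrt (\<bar>z\<bar> / pi)"
  have \<rho>: "pi * \<rho>\<^sup>2 = \<bar>z\<bar>" by (simp add: \<rho>_def)
  have "s * pi * \<rho>\<^sup>2 = z"
    using \<rho> by (simp add: s_def)
  moreover have "2 * pi * \<rho> = sqrt (4 * pi * \<bar>z\<bar>)"
  proof (rule real_sqrt_unique[symmetric])
    have "(2 * pi * \<rho>)\<^sup>2 = 4 * pi * (pi * \<rho>\<^sup>2)"
      by (simp add: power2_eq_square)
    then show "(2 * pi * \<rho>)\<^sup>2 = 4 * pi * \<bar>z\<bar>"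
      by (simp only: \<rho>)
  qed (simp add: \<rho>_def)
  moreover have "r\<^sup>2 * e1 * e2 = x * y"
    by (simp add: e(2,3) power2_eq_square)
  ultimately show ?thesis
    using segment_plus_circle_bound[OF e(1), of r \<rho> s]
    by (simp add: r_def[symmetric] e(2,3)[symmetric] \<rho>_def s_def add.commute) (simp add: r_def)
qed

section \<open>Covering the nilmanifold\<close>

text \<open>
  A lattice element \<open>(k, l, m)\<close> shifts \<open>x\<close> by \<open>k\<close> and \<open>y\<close> by \<open>l\<close>.  Once \<open>k\<close> and \<open>l\<close> have been
  chosen, \<open>m\<close> shifts \<open>z\<close> alone, so all three coordinates can be rounded to the nearest integer.
\<close>

lemma nilmanifold_reduced_representative:
  assumes "q \<in> nilmanifold"
  obtains x y z where "q = nil_proj (x, y, z + x * y / 2)" "\<bar>x\<bar> \<le> 1/2" "\<bar>y\<bar> \<le> 1/2" "\<bar>z\<bar> \<le> 1/2"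
proof -
  obtain a b c where q: "q = nil_proj (a, b, c)"
    using nilmanifoldE[OF assms] by (metis prod_cases3)
  define k l where "k = real_of_int (- round a)" and "l = real_of_int (- round b)"
  define x y where "x = a + k" and "y = b + l"
  \<comment> \<open>The symmetric third coordinate of \<open>(k, l, 0) \<cdot> (a, b, c)\<close>.\<close>
  define w where "w = c + k * b - x * y / 2"
  define m where "m = real_of_int (- round w)"
  have "(k, l, m) \<in> HeisZ" by (simp add: HeisZ_def k_def l_def m_def)
  from nil_proj_HeisZ_mult[OF this, of "(a, b, c)"]
  have "q = nil_proj (x, y, (w + m) + x * y / 2)"
    by (simp add: q x_def y_def w_def algebra_simps)
  moreover have "\<bar>x\<bar> \<le> 1/2" "\<bar>y\<bar> \<le> 1/2" "\<bar>w + m\<bar> \<le> 1/2"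
    using of_int_round_abs_le[of a] of_int_round_abs_le[of b] of_int_round_abs_le[of w]
    by (auto simp: x_def y_def k_def l_def m_def abs_minus_commute)
  ultimately show ?thesis by (rule that)
qed

lemma nil_dist_origin_le:
  assumes "q \<in> nilmanifold"
  shows "nil_dist (nil_proj (0, 0, 0)) q \<le> sqrt (1/2) + sqrt (2 * pi)"
proof -
  obtain x y z where q: "q = nil_proj (x, y, z + x * y / 2)"
    and xyz: "\<bar>x\<bar> \<le> 1/2" "\<bar>y\<bar> \<le> 1/2" "\<bar>z\<bar> \<le> 1/2"
    using nilmanifold_reduced_representative[OF assms] by blast
  have "x\<^sup>2 \<le> (1/2)\<^sup>2" "y\<^sup>2 \<le> (1/2)\<^sup>2"
    using xyz by (simp_all only: abs_le_square_iff[symmetric])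
  then have "sqrt (x\<^sup>2 + y\<^sup>2) \<le> sqrt (1/2)"
    by (intro real_sqrt_le_mono) (simp add: power2_eq_square)
  moreover have "sqrt (4 * pi * \<bar>z\<bar>) \<le> sqrt (2 * pi)"
    using xyz(3) by (intro real_sqrt_le_mono) simp
  ultimately show ?thesis
    using nil_dist_symmetric_coordinates_le[of x y z] unfolding q by linarith
qed

lemma t_star_bounds: "3.562 < t_star" "t_star < 3.564"
proof -
  have pi2: "3.1415\<^sup>2 \<le> pi\<^sup>2" "pi\<^sup>2 \<le> 3.1416\<^sup>2"
    using pi_approx by (intro power_mono; simp)+
  have "100.52 < sqrt (1 + 1024 * pi\<^sup>2)" "sqrt (1 + 1024 * pi\<^sup>2) < 100.56"
    using pi2
    by (intro real_less_rsqrt real_less_lsqrt; simp add: power2_eq_square)+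
  then have "7.124 < sqrt (1 / 2 * (1 + sqrt (1 + 1024 * pi\<^sup>2)))"
    "sqrt (1 / 2 * (1 + sqrt (1 + 1024 * pi\<^sup>2))) < 7.128"
    by (intro real_less_rsqrt real_less_lsqrt; simp add: power2_eq_square)+
  then show "3.562 < t_star" "t_star < 3.564"
    by (simp_all add: t_star_def)
qed

theorem theorem9p3:
  shows "t_bar \<le> t_star \<and> \<bar>t_star - 3.56\<bar> < 0.005"
proof
  have "sqrt (1/2) < (0.72 :: real)"
    by (intro real_less_lsqrt) (auto simp: power2_eq_square)
  moreover have "sqrt (2 * pi) < 2.6"
    using pi_approx by (intro real_less_lsqrt) (auto simp: power2_eq_square)
  ultimately have "nil_ball (nil_proj \<one>\<^bsub>Heis\<^esub>) t_star = nilmanifold"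
    using nil_dist_origin_le t_star_bounds by (fastforce simp: nil_ball_def Heis_def)
  then show "t_bar \<le> t_star"
    unfolding t_bar_def using t_star_bounds
    by (intro cInf_lower) (auto intro!: bdd_belowI[of _ 0])
  show "\<bar>t_star - 3.56\<bar> < 0.005"
    using t_star_bounds by (simp add: abs_less_iff)
qed

end
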